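(* Let $X$ and $Y$ be connected CW complexes, let $f\colon X\to Y$ be a map, and let $n\ge 2$. Then $$\operatorname{TC}_n(f)\le \min\{\operatorname{TC}_n(X),\operatorname{TC}_n(Y)\}.$$
   Context: All maps are continuous and $I=[0,1]$. Sectional category: for a fibration $p\colon E\to B$, $\operatorname{secat}(p)$ is the least non-negative integer $k$ such that $B$ is covered by $k+1$ open sets on each of which $p$ has a (continuous) section; it is $\infty$ if no such $k$ exists. Higher topological complexity of a space: for $n\ge 2$ and a path-connected CW complex $X$, let $X^I$ be the free path space with the compact-open topology and let $\pi_n\colon X^I\to X^n$ be the fibration $\pi_n(\alpha)=\left(\alpha(0),\alpha\left(\tfrac1{n-1}\right),\dots,\alpha\left(\tfrac{n-2}{n-1}\right),\alpha(1)\right)$. Then $\operatorname{TC}_n(X):=\operatorname{secat}(\pi_n)$. Quasi-strong LS category: for a map of pairs $h\colon (B,C)\to (P,A)$, $\operatorname{qscat}(h)$ is the least non-negative integer $m$ such that $B$ can be covered by open sets $V_0,\dots,V_m$ such that for each $i$ there is a homotopy $H_i\colon V_i\times[0,1]\to P$ with $H_i(-,1)=h|_{V_i}$ and $H_i(V_i,0)\subseteq A$ (and $\infty$ if no such $m$ exists). Topological complexity of a map: let $X,Y$ be path-connected spaces, $f\colon X\to Y$ a map, and $n\ge 2$. Let $\Delta_n\colon X\to X^n$, $x\mapsto (x,\dots,x)$, be the diagonal map, and similarly for $Y$. Let $f^n=f\times\cdots\times f\colon X^n\to Y^n$ and let $\overline{f^n}\colon (X^n,\Delta_n(X))\to (Y^n,\Delta_n(Y))$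 be the induced map of pairs. Then $\operatorname{TC}_n(f):=\operatorname{qscat}(\overline{f^n})$. *)

theory Defs
  imports "HOL-Analysis.Analysis" "HOL-Library.Extended_Nat"
begin

subsection \<open>CW complexes\<close>

text \<open>Closed disc, open disc and sphere in the first \<open>n\<close> coordinates. For \<open>n = 0\<close> both discs are
  a point and the sphere is empty.\<close>

definition cell_disc :: "nat \<Rightarrow> (nat \<Rightarrow> real) set" where
  "cell_disc n = {x \<in> topspace (Euclidean_space n). (\<Sum>i<n. (x i)\<^sup>2) \<le> 1}"

definition cell_interior :: "nat \<Rightarrow> (nat \<Rightarrow> real) set" where
  "cell_interior n = {x \<in> topspace (Euclidean_space n). (\<Sum>i<n. (x i)\<^sup>2) < 1}"

definition cell_boundary :: "nat \<Rightarrow> (nat \<Rightarrow> real) set" where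
  "cell_boundary n = {x \<in> topspace (Euclidean_space n). (\<Sum>i<n. (x i)\<^sup>2) = 1}"

text \<open>\<open>cells n\<close> is the set of open \<open>n\<close>-cells and \<open>\<Phi> n e\<close> is the characteristic map of \<open>e \<in> cells n\<close>.
  The last two clauses are closure-finiteness and the weak topology.\<close>

definition cw_structure ::
  "'a topology \<Rightarrow> (nat \<Rightarrow> 'a set set) \<Rightarrow> (nat \<Rightarrow> 'a set \<Rightarrow> (nat \<Rightarrow> real) \<Rightarrow> 'a) \<Rightarrow> bool" where
  "cw_structure X cells \<Phi> \<longleftrightarrow>
     Hausdorff_space X \<and>
     (\<Union>n. \<Union>(cells n)) = topspace X \<and>
     (\<forall>m n d e. d \<in> cells m \<and> e \<in> cells n \<and> (m, d) \<noteq> (n, e) \<longrightarrow> disjnt d e) \<and>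
     (\<forall>n. \<forall>e \<in> cells n.
        continuous_map (subtopology (Euclidean_space n) (cell_disc n)) X (\<Phi> n e) \<and>
        homeomorphic_map (subtopology (Euclidean_space n) (cell_interior n))
          (subtopology X e) (\<Phi> n e) \<and>
        (\<exists>F. finite F \<and> F \<subseteq> (\<Union>m<n. cells m) \<and> \<Phi> n e ` cell_boundary n \<subseteq> \<Union>F)) \<and>
     (\<forall>A. A \<subseteq> topspace X \<longrightarrow>
        (closedin X A \<longleftrightarrow> (\<forall>n. \<forall>e \<in> cells n. closedin X (A \<inter> X closure_of e))))"

definition CW_complex :: "'a topology \<Rightarrow> bool" where
  "CW_complex X \<longleftrightarrow> (\<exists>cells \<Phi>. cw_structure X cells \<Phi>)"


subsection \<open>Sectional category\<close>

text \<open>The infimum of the empty set of extended naturals is \<open>\<infinity>\<close>.\<close>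

definition secat :: "'e topology \<Rightarrow> 'b topology \<Rightarrow> ('e \<Rightarrow> 'b) \<Rightarrow> enat" where
  "secat E B p = Inf {enat k | k. \<exists>U :: nat \<Rightarrow> 'b set.
     (\<forall>i\<le>k. openin B (U i)) \<and> (\<Union>i\<le>k. U i) = topspace B \<and>
     (\<forall>i\<le>k. \<exists>s. continuous_map (subtopology B (U i)) E s \<and> (\<forall>b \<in> U i. p (s b) = b))}"


subsection \<open>Path spaces and higher topological complexity of a space\<close>

text \<open>A continuous map on \<open>K\<close> is represented by its extensional function, with value
  \<open>undefined\<close> outside \<open>topspace K\<close>, so that equality of points is equality of maps.\<close>

definition maps_into :: "'k topology \<Rightarrow> 'a topology \<Rightarrow> ('k \<Rightarrow> 'a) set" where
  "maps_into K X = {g \<in> extensional (topspace K). continuous_map K X g}"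

definition compact_open_topology :: "'k topology \<Rightarrow> 'a topology \<Rightarrow> ('k \<Rightarrow> 'a) topology" where
  "compact_open_topology K X =
     topology_generated_by {{g \<in> maps_into K X. g ` C \<subseteq> U} | C U. compactin K C \<and> openin X U}"

abbreviation unit_interval :: "real topology" where
  "unit_interval \<equiv> top_of_set {0..1}"

definition free_path_space :: "'a topology \<Rightarrow> (real \<Rightarrow> 'a) topology" where
  "free_path_space X = compact_open_topology unit_interval X"

text \<open>The coordinates of \<open>X\<^sup>n\<close> are indexed by \<open>0, \<dots>, n - 1\<close>.\<close>

definition cartesian_power :: "nat \<Rightarrow> 'a topology \<Rightarrow> (nat \<Rightarrow> 'a) topology" where
  "cartesian_power n X = product_topology (\<lambda>_. X) {..<n}"

definition path_fibration :: "nat \<Rightarrow> (real \<Rightarrow> 'a) \<Rightarrow> (nat \<Rightarrow> 'a)" where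
  "path_fibration n \<alpha> = (\<lambda>j\<in>{..<n}. \<alpha> (real j / (real n - 1)))"

definition TC_space :: "nat \<Rightarrow> 'a topology \<Rightarrow> enat" where
  "TC_space n X = secat (free_path_space X) (cartesian_power n X) (path_fibration n)"


subsection \<open>Quasi-strong category and topological complexity of a map\<close>

text \<open>The arguments represent a map of pairs \<open>h : (B, C) \<rightarrow> (P, A)\<close>. As in the usual
  definition, the condition on the cover does not involve \<open>C\<close>.\<close>

definition qscat ::
  "'b topology \<Rightarrow> 'b set \<Rightarrow> 'p topology \<Rightarrow> 'p set \<Rightarrow> ('b \<Rightarrow> 'p) \<Rightarrow> enat" where
  "qscat B C P A h = Inf {enat m | m. \<exists>V :: nat \<Rightarrow> 'b set.
     (\<forall>i\<le>m. openin B (V i)) \<and> (\<Union>i\<le>m. V i) = topspace B \<and>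
     (\<forall>i\<le>m. \<exists>H. continuous_map (prod_topology (subtopology B (V i)) unit_interval) P H \<and>
        (\<forall>b \<in> V i. H (b, 1) = h b) \<and> (\<forall>b \<in> V i. H (b, 0) \<in> A))}"

definition diagonal_map :: "nat \<Rightarrow> 'a \<Rightarrow> (nat \<Rightarrow> 'a)" where
  "diagonal_map n x = (\<lambda>j\<in>{..<n}. x)"

definition power_map :: "nat \<Rightarrow> ('a \<Rightarrow> 'b) \<Rightarrow> (nat \<Rightarrow> 'a) \<Rightarrow> (nat \<Rightarrow> 'b)" where
  "power_map n f x = (\<lambda>j\<in>{..<n}. f (x j))"

definition TC_map :: "nat \<Rightarrow> 'a topology \<Rightarrow> 'b topology \<Rightarrow> ('a \<Rightarrow> 'b) \<Rightarrow> enat" where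
  "TC_map n X Y f =
     qscat (cartesian_power n X) (diagonal_map n ` topspace X)
       (cartesian_power n Y) (diagonal_map n ` topspace Y) (power_map n f)"

end

theory Submission
  imports Defs
begin

text \<open>The motion \<open>\<alpha> \<mapsto> (\<alpha> 0, \<alpha> (t / (n - 1)), \<dots>, \<alpha> t)\<close> deforms the path fibration into a map
  with diagonal values, as \<open>t\<close> runs from 1 down to 0. Composing it with a local section of the path
  fibration of \<open>X\<close> and then with \<open>f\<^sup>n\<close> gives the bound by \<open>TC\<^sub>n(X)\<close>; precomposing it with a local
  section of the path fibration of \<open>Y\<close> pulled back along \<open>f\<^sup>n\<close> gives the bound by \<open>TC\<^sub>n(Y)\<close>.\<close>

lemma topspace_compact_open_topology [simp]:
  "topspace (compact_open_topology K X) = maps_into K X"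
proof -
  \<comment> \<open>With the empty compact set the condition on \<open>g\<close> is vacuous, so all
    of \<open>maps_into K X\<close> is one of the generating sets.\<close>
  have "maps_into K X \<in> {{g \<in> maps_into K X. g ` C \<subseteq> U} | C U. compactin K C \<and> openin X U}"
    by (intro CollectI exI[of _ "{}"]) auto
  then show ?thesis
    unfolding compact_open_topology_def by auto
qed

lemma openin_compact_open_topology_subbasic:
  assumes "compactin K C" "openin X U"
  shows "openin (compact_open_topology K X) {g \<in> maps_into K X. g ` C \<subseteq> U}"
  unfolding compact_open_topology_def using assms
  by (intro topology_generated_by_Basis) blast

text \<open>Since compact neighbourhoods form a base in \<open>K\<close>, the point \<open>t\<close>
  has one, \<open>C\<close>, inside the open preimage of \<open>U\<close> under \<open>g\<close>.
  Maps sending \<open>C\<close> into \<open>U\<close>, paired with times in the open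
  \<open>W\<close> inside \<open>C\<close>, then evaluate into \<open>U\<close>.\<close>

lemma continuous_map_compact_open_eval:
  assumes "locally_compact_space K" "Hausdorff_space K \<or> regular_space K"
  shows "continuous_map (prod_topology (compact_open_topology K X) K) X (\<lambda>(g, t). g t)"
proof (subst continuous_map, intro conjI allI impI)
  show "(\<lambda>(g, t). g t) ` topspace (prod_topology (compact_open_topology K X) K) \<subseteq> topspace X"
    by (auto simp: maps_into_def continuous_map_def)
  fix U assume U: "openin X U"
  let ?S = "{z \<in> topspace (prod_topology (compact_open_topology K X) K). (case z of (g, t) \<Rightarrow> g t) \<in> U}"
  show "openin (prod_topology (compact_open_topology K X) K) ?S"
  proof (subst openin_subopen, intro ballI)
    fix z assume z: "z \<in> ?S"
    obtain g t where gt: "z = (g, t)" by force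
    have g: "g \<in> maps_into K X" and t: "t \<in> topspace K" "g t \<in> U"
      using z gt by auto
    have "openin K {x \<in> topspace K. g x \<in> U}"
      using g U by (auto simp: maps_into_def intro: openin_continuous_map_preimage)
    moreover have "neighbourhood_base_of (compactin K) K"
      using assms locally_compact_space_neighbourhood_base by blast
    ultimately obtain W C where W: "openin K W" "compactin K C" "t \<in> W" "W \<subseteq> C"
        "C \<subseteq> {x \<in> topspace K. g x \<in> U}"
      using t unfolding neighbourhood_base_of
      by (elim allE[of _ "{x \<in> topspace K. g x \<in> U}"] allE[of _ t]) auto
    let ?T = "{h \<in> maps_into K X. h ` C \<subseteq> U} \<times> W"
    have "openin (prod_topology (compact_open_topology K X) K) ?T"
      using openin_compact_open_topology_subbasic[OF W(2) U] W(1) by (simp add: openin_prod_Times_iff)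
    moreover have "z \<in> ?T" using g W gt by auto
    moreover have "?T \<subseteq> ?S"
      using W(4) openin_subset[OF W(1)] by (auto dest!: subsetD)
    ultimately show "\<exists>T. openin (prod_topology (compact_open_topology K X) K) T \<and> z \<in> T \<and> T \<subseteq> ?S"
      by blast
  qed
qed

lemma continuous_map_free_path_eval:
  "continuous_map (prod_topology (free_path_space X) unit_interval) X (\<lambda>(\<alpha>, t). \<alpha> t)"
  unfolding free_path_space_def
proof (rule continuous_map_compact_open_eval)
  show "locally_compact_space unit_interval"
    by (intro compact_imp_locally_compact_space) (simp add: compact_space_subtopology)
  show "Hausdorff_space unit_interval \<or> regular_space unit_interval"
    by (simp add: Hausdorff_space_subtopology)
qed

text \<open>This is \<open>path_fibration n\<close> of the shortened path s -> \<alpha>(t * s).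
  Writing it coordinatewise reduces its continuity to that of evaluation, without a
  reparametrisation map on the path space.\<close>

definition contracted_path_fibration :: "nat \<Rightarrow> (real \<Rightarrow> 'a) \<times> real \<Rightarrow> nat \<Rightarrow> 'a" where
  "contracted_path_fibration n = (\<lambda>(\<alpha>, t). \<lambda>j\<in>{..<n}. \<alpha> (t * (real j / (real n - 1))))"

lemma continuous_map_contracted_path_fibration:
  "continuous_map (prod_topology (free_path_space X) unit_interval) (cartesian_power n X)
     (contracted_path_fibration n)"
  unfolding cartesian_power_def
proof (subst continuous_map_componentwise, intro conjI ballI)
  show "contracted_path_fibration n ` topspace (prod_topology (free_path_space X) unit_interval)
    \<subseteq> extensional {..<n}"
    by (auto simp: contracted_path_fibration_def)
  fix j assume j: "j \<in> {..<n}"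
  define c where "c = real j / (real n - 1)"
  \<comment> \<open>The bound is j \<le> n - 1; for n = 1 the quotient 0 / 0 is 0 by convention.
    Scaling by \<open>c\<close> thus keeps times in the unit interval.\<close>
  have c: "0 \<le> c" "c \<le> 1"
    using j by (auto simp: c_def divide_simps)
  have "continuous_map unit_interval unit_interval (\<lambda>t. t * c)"
    using c by (auto simp: mult_le_one continuous_map_in_subtopology continuous_map_iff_continuous2 intro!: continuous_on_mult)
  then have "continuous_map (prod_topology (free_path_space X) unit_interval) unit_interval
      (\<lambda>z. snd z * c)"
    by (rule continuous_map_compose[OF continuous_map_snd, unfolded o_def])
  then have "continuous_map (prod_topology (free_path_space X) unit_interval)
      (prod_topology (free_path_space X) unit_interval) (\<lambda>z. (fst z, snd z * c))"
    by (intro continuous_map_pairedI continuous_map_fst)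
  from continuous_map_compose[OF this continuous_map_free_path_eval]
  show "continuous_map (prod_topology (free_path_space X) unit_interval) X
      (\<lambda>z. contracted_path_fibration n z j)"
    using j by (simp add: o_def contracted_path_fibration_def c_def case_prod_unfold)
qed

lemma contracted_path_fibration_1: "contracted_path_fibration n (\<alpha>, 1) = path_fibration n \<alpha>"
  by (simp add: contracted_path_fibration_def path_fibration_def)

lemma contracted_path_fibration_0: "contracted_path_fibration n (\<alpha>, 0) = diagonal_map n (\<alpha> 0)"
  by (simp add: contracted_path_fibration_def diagonal_map_def)

lemma free_path_space_start:
  "\<alpha> \<in> topspace (free_path_space X) \<Longrightarrow> \<alpha> 0 \<in> topspace X"
  by (auto simp: free_path_space_def maps_into_def continuous_map_def)

lemma continuous_map_power_map:
  assumes "continuous_map X Y f"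
  shows "continuous_map (cartesian_power n X) (cartesian_power n Y) (power_map n f)"
  unfolding cartesian_power_def power_map_def
proof (subst continuous_map_componentwise, intro conjI ballI)
  fix j assume "j \<in> {..<n}"
  then show "continuous_map (product_topology (\<lambda>_. X) {..<n}) Y (\<lambda>x. (\<lambda>j\<in>{..<n}. f (x j)) j)"
    using continuous_map_compose[OF continuous_map_product_projection[of j "{..<n}" "\<lambda>_. X"] assms]
    by (simp add: o_def)
qed auto

lemma power_map_diagonal_map: "power_map n f (diagonal_map n x) = diagonal_map n (f x)"
  by (auto simp: power_map_def diagonal_map_def)

text \<open>The common form of both bounds: \<open>G\<close> deforms \<open>l \<circ> p\<close> into
  \<open>A\<close>, and \<open>h\<close> factors as \<open>l \<circ> k\<close>. A section
  \<open>s\<close> of \<open>p\<close> over \<open>U i\<close>, pulled back along \<open>k\<close>,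
  gives the homotopy \<open>G (s (k b), t)\<close>, which ends at
  \<open>l (p (s (k b))) = l (k b) = h b\<close>.\<close>

lemma qscat_le_secat:
  assumes k: "continuous_map B D k"
    and G: "continuous_map (prod_topology E unit_interval) P G"
    and G1: "\<And>e. e \<in> topspace E \<Longrightarrow> G (e, 1) = l (p e)"
    and G0: "\<And>e. e \<in> topspace E \<Longrightarrow> G (e, 0) \<in> A"
    and h: "\<And>b. b \<in> topspace B \<Longrightarrow> h b = l (k b)"
  shows "qscat B C P A h \<le> secat E D p"
  unfolding qscat_def secat_def
\<comment> \<open>Every \<open>m\<close> admissible for \<open>secat\<close> is shown admissible for
  \<open>qscat\<close>; if there is none, the right-hand side is \<infinity>.\<close>
proof (rule Inf_superset_mono, clarify)
  fix m :: nat and U :: "nat \<Rightarrow> 'b set"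
  assume U: "\<forall>i\<le>m. openin D (U i)" "(\<Union>i\<le>m. U i) = topspace D"
    and sec: "\<forall>i\<le>m. \<exists>s. continuous_map (subtopology D (U i)) E s \<and> (\<forall>b\<in>U i. p (s b) = b)"
  define V where "V i = {b \<in> topspace B. k b \<in> U i}" for i
  have "\<forall>i\<le>m. openin B (V i)"
    using U k by (auto simp: V_def intro: openin_continuous_map_preimage)
  moreover have "(\<Union>i\<le>m. V i) = topspace B"
    using U(2) k unfolding V_def continuous_map_def by blast
  moreover have "\<exists>H. continuous_map (prod_topology (subtopology B (V i)) unit_interval) P H \<and>
      (\<forall>b\<in>V i. H (b, 1) = h b) \<and> (\<forall>b\<in>V i. H (b, 0) \<in> A)" if i: "i \<le> m" for i
  proof -
    obtain s where s: "continuous_map (subtopology D (U i)) E s" "\<And>b. b \<in> U i \<Longrightarrow> p (s b) = b"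
      using sec i by blast
    have "continuous_map (subtopology B (V i)) (subtopology D (U i)) k"
      using k by (auto simp: continuous_map_in_subtopology V_def continuous_map_from_subtopology)
    then have sk: "continuous_map (subtopology B (V i)) E (s \<circ> k)"
      using s(1) by (rule continuous_map_compose)
    let ?H = "G \<circ> (\<lambda>(b, t). ((s \<circ> k) b, t))"
    have "continuous_map (prod_topology (subtopology B (V i)) unit_interval) P ?H"
      using sk by (intro continuous_map_compose[OF _ G]) (simp add: continuous_map_prod_top o_def)
    \<comment> \<open>The endpoint conditions on \<open>G\<close> are assumed only over points of
      \<open>E\<close>.\<close>
    moreover have "s (k b) \<in> topspace E" if "b \<in> V i" for b
      using sk that by (auto simp: continuous_map_def V_def Pi_iff)
    ultimately show ?thesis
      using s(2) G1 G0 h by (intro exI[of _ ?H]) (auto simp: V_def)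
  qed
  ultimately show "\<exists>m'. enat m = enat m' \<and> (\<exists>V. (\<forall>i\<le>m'. openin B (V i)) \<and>
      (\<Union>i\<le>m'. V i) = topspace B \<and>
      (\<forall>i\<le>m'. \<exists>H. continuous_map (prod_topology (subtopology B (V i)) unit_interval) P H \<and>
        (\<forall>b\<in>V i. H (b, 1) = h b) \<and> (\<forall>b\<in>V i. H (b, 0) \<in> A)))"
    by blast
qed

text \<open>Here \<open>k\<close> is the identity and \<open>l\<close> is
  \<open>power_map n f\<close>: the deformation takes place in the power of \<open>X\<close> and is
  then pushed forward, which carries diagonal points to diagonal points.\<close>

lemma TC_map_le_TC_space_domain:
  assumes f: "continuous_map X Y f"
  shows "TC_map n X Y f \<le> TC_space n X"
  unfolding TC_map_def TC_space_def
proof (rule qscat_le_secat)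
  show "continuous_map (cartesian_power n X) (cartesian_power n X) (\<lambda>x. x)"
    by simp
  show "continuous_map (prod_topology (free_path_space X) unit_interval) (cartesian_power n Y)
      (power_map n f \<circ> contracted_path_fibration n)"
    using continuous_map_contracted_path_fibration continuous_map_power_map[OF f]
    by (rule continuous_map_compose)
  fix \<alpha> assume "\<alpha> \<in> topspace (free_path_space X)"
  then have "f (\<alpha> 0) \<in> topspace Y"
    using f by (auto simp: continuous_map_def dest: free_path_space_start)
  then show "(power_map n f \<circ> contracted_path_fibration n) (\<alpha>, 0) \<in> diagonal_map n ` topspace Y"
    by (simp add: contracted_path_fibration_0 power_map_diagonal_map)
qed (simp_all add: contracted_path_fibration_1)

text \<open>The roles are exchanged: \<open>k\<close> is \<open>power_map n f\<close> and
  \<open>l\<close> is the identity, so the cover is pulled back from the power of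
  \<open>Y\<close>.\<close>

lemma TC_map_le_TC_space_codomain:
  assumes f: "continuous_map X Y f"
  shows "TC_map n X Y f \<le> TC_space n Y"
  unfolding TC_map_def TC_space_def
proof (rule qscat_le_secat)
  show "continuous_map (cartesian_power n X) (cartesian_power n Y) (power_map n f)"
    using f by (rule continuous_map_power_map)
  show "continuous_map (prod_topology (free_path_space Y) unit_interval) (cartesian_power n Y)
      (contracted_path_fibration n)"
    by (rule continuous_map_contracted_path_fibration)
  show "contracted_path_fibration n (\<alpha>, 1) = (\<lambda>y. y) (path_fibration n \<alpha>)" for \<alpha> :: "real \<Rightarrow> 'b"
    by (simp add: contracted_path_fibration_1)
qed (simp_all add: contracted_path_fibration_0 free_path_space_start)

theorem proposition3p9:
  fixes X :: "'a topology" and Y :: "'b topology" and f :: "'a \<Rightarrow> 'b" and n :: nat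
  assumes "CW_complex X" and "connected_space X"
    and "CW_complex Y" and "connected_space Y"
    and "continuous_map X Y f"
    and "n \<ge> 2"
  shows "TC_map n X Y f \<le> min (TC_space n X) (TC_space n Y)"
  using assms TC_map_le_TC_space_domain TC_map_le_TC_space_codomain by auto

end
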